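(* Let $a>0$ and $\alpha\in[0,1]$. Let $Y\sim G$ be a random variable with values in $\mathbb{R}_+=[0,\infty)$ having finite moments of all positive integer orders, and let $G$ be absolutely continuous on $\mathbb{R}_{+,x_0}=[x_0,\infty)$ for some $x_0>\mathrm{e}$ with density $G'(x)=g(x)>0$ on $\mathbb{R}_{+,x_0}$. If $$\limsup_{x\to\infty}\frac{g(x+a(\log x)^{\alpha}+\log\log x)}{g(x)}<1,$$ then both $Y$ and $Y^2$ are M-det on $\mathbb{R}_+$.
   Context: $Y\sim G$ means that the random variable $Y$ has distribution (function) $G$. The distribution $G$ is arbitrary on $[0,x_0)$; only its restriction to $[x_0,\infty)$ is assumed absolutely continuous. M-determinacy: a random variable with values in $\mathbb{R}_+$ and finite moments of all orders is M-det (moment-determinate) on $\mathbb{R}_+$ if no probability distribution on $\mathbb{R}_+$ other than its own has the same moment sequence (moments of all orders $n\in\mathbb{N}=\{1,2,\ldots\}$). *)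

theory Defs
  imports "HOL-Probability.Probability"
begin

definition nonneg_rv_all_moments :: "'a measure \<Rightarrow> ('a \<Rightarrow> real) \<Rightarrow> bool" where
  "nonneg_rv_all_moments M X \<longleftrightarrow>
     prob_space M \<and> X \<in> borel_measurable M \<and> (\<forall>\<omega>\<in>space M. 0 \<le> X \<omega>) \<and>
     (\<forall>n\<ge>1. integrable M (\<lambda>\<omega>. X \<omega> ^ n))"

text \<open>
  Moment-determinacy on the half-line. A competing law \<open>N\<close> is a Borel probability measure on the
  reals concentrated on the nonnegative half-line; integrability is stated explicitly because the
  integral of a non-integrable function is 0 by convention.
\<close>

definition M_det :: "'a measure \<Rightarrow> ('a \<Rightarrow> real) \<Rightarrow> bool" where
  "M_det M X \<longleftrightarrow>
     nonneg_rv_all_moments M X \<and>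
     (\<forall>N :: real measure.
        real_distribution N \<longrightarrow> (AE x in N. 0 \<le> x) \<longrightarrow>
        (\<forall>n\<ge>1. integrable N (\<lambda>x. x ^ n) \<and>
               integral\<^sup>L N (\<lambda>x. x ^ n) = integral\<^sup>L M (\<lambda>\<omega>. X \<omega> ^ n)) \<longrightarrow>
        N = distr M borel X)"

text \<open>
  The distribution function \<open>G\<close> is absolutely continuous on \<open>[x0, \<infinity>)\<close> with density \<open>g\<close>: on that
  half-line it is the indefinite Lebesgue integral of \<open>g\<close>, so \<open>G' = g\<close> almost everywhere there.
  Nothing is required of \<open>G\<close>, or of \<open>g\<close>, to the left of \<open>x0\<close>.
\<close>

definition abs_cont_from_with_density :: "(real \<Rightarrow> real) \<Rightarrow> real \<Rightarrow> (real \<Rightarrow> real) \<Rightarrow> bool" where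
  "abs_cont_from_with_density G x0 g \<longleftrightarrow>
     (\<forall>x\<ge>x0. set_integrable lborel {x0..x} g \<and>
             G x = G x0 + set_lebesgue_integral lborel {x0..x} g)"

end

theory Submission
  imports Defs "HOL-Real_Asymp.Real_Asymp"
begin

text \<open>
  The hypothesis says that a shift by \<open>s(x) = a (ln x)\<^sup>\<alpha> + ln (ln x)\<close>, which is at most
  \<open>(a + 1) ln x\<close>, shrinks the density by a fixed factor \<open>q < 1\<close>. Hence the tail decays at least roughly
  like \<open>exp (- c x / ln x)\<close>, and the moments of \<open>Y\<close> are of order at most \<open>(C n ln n)\<^sup>n\<close>. The moment of order
  \<open>n\<close> of \<open>Y\<^sup>2\<close> is the moment of order \<open>2 n\<close> of \<open>Y\<close>, and \<open>\<Sum> 1 / (n ln n)\<close> diverges, so both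
  variables satisfy Carleman's condition for the half-line.
  
  The moment bound needs no tail estimate. With \<open>T x = x + s(x)\<close>, substitution in the density gives
  \<open>E[\<phi>(Y); Y > T r] \<le> \<rho> E[\<phi>(T Y); Y > r]\<close> for nonnegative \<open>\<phi>\<close> and some \<open>\<rho> < 1\<close>
  (\<open>nn_integral_tail_shift_le\<close>), because \<open>T' \<longlongrightarrow> 1\<close>. For \<open>\<phi> y = y\<^sup>n\<close>, the factor \<open>(T x / x)\<^sup>n\<close> is
  close to 1 once \<open>x\<close> exceeds a multiple \<open>R\<close> of \<open>n ln n\<close>. The moment then occurs on both sides of
  the inequality, on the right with a coefficient below 1, and can be absorbed; what remains is
  \<open>(T R)\<^sup>n\<close> up to a constant (\<open>moment_growth_of_tail_contraction\<close>).
  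
  Determinacy is quasi-analyticity of characteristic functions. If two laws have the same
  moments, all derivatives of the difference \<open>D\<close> of their characteristic functions vanish at 0. Bang's
  argument for the Denjoy-Carleman theorem propagates this flatness: Taylor's formula shows that
  a bound of size \<open>e\<^sup>-\<^sup>k\<close> on the derivatives of order below \<open>k\<close>, scaled by products
  \<open>\<mu>\<^sub>0 \<dots> \<mu>\<^sub>n\<^sub>-\<^sub>1\<close> that dominate the moments, worsens only to \<open>e\<^sup>2\<^sup>-\<^sup>k\<close> over a step of length
  \<open>2 / (e \<mu>\<^sub>k)\<close>. As the sum of these lengths diverges, \<open>D\<close> vanishes everywhere
  (\<open>quasi_analytic\<close>), and the laws agree by Levy's uniqueness theorem.
  
  For \<open>Y\<close> this applies directly. For \<open>Y\<^sup>2\<close> the half-line must be used, since its moments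
  may grow too fast for the criterion on the line. A law on the half-line is therefore replaced by
  the law of its square root with a random sign: the even moments of the new law are the moments of
  the old one, its odd moments vanish, and squaring recovers the old law
  (\<open>square_random_sign_sqrt\<close>).
\<close>

section \<open>Bang's quasi-analyticity argument\<close>

lemma prod_nondecreasing_split_le:
  fixes \<mu> :: "nat \<Rightarrow> real"
  assumes "mono \<mu>" and pos: "\<And>j. 0 < \<mu> j" and "n + i \<le> Suc k"
  shows "(\<Prod>j<n + i. \<mu> j) \<le> (\<Prod>j<n. \<mu> j) * \<mu> k ^ i"
  using assms(3)
proof (induction i)
  case 0
  then show ?case by simp
next
  case (Suc i)
  have IH: "(\<Prod>j<n + i. \<mu> j) \<le> (\<Prod>j<n. \<mu> j) * \<mu> k ^ i"
    using Suc by simp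
  have "\<mu> (n + i) \<le> \<mu> k"
    using monoD[OF assms(1)] Suc.prems by simp
  then have "(\<Prod>j<n + i. \<mu> j) * \<mu> (n + i) \<le> (\<Prod>j<n. \<mu> j) * \<mu> k ^ i * \<mu> k"
    using IH pos by (intro mult_mono) (auto intro!: prod_nonneg mult_nonneg_nonneg simp: less_imp_le)
  then show ?case
    by (simp add: mult_ac)
qed

lemma exp_partial_sum_le:
  fixes x :: real
  assumes "0 \<le> x"
  shows "(\<Sum>i\<le>N. x ^ i / fact i) \<le> exp x"
proof -
  have "(\<Sum>i\<le>N. x ^ i / fact i) \<le> (\<Sum>i. x ^ i / fact i)"
    using assms summable_exp[of x]
    by (intro sum_le_suminf) (auto simp: divide_inverse mult.commute)
  then show ?thesis
    by (simp add: exp_def divide_inverse mult.commute)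
qed

text \<open>
  The derivatives of a smooth function enter only through the Taylor estimate, as a family \<open>D n\<close>.
  Remainders are required at even orders \<open>2 m\<close> only: for a characteristic function they are then
  controlled by even moments, which are integrals of nonnegative powers and coincide for laws
  with the same moments.
\<close>
locale taylor_family =
  fixes D :: "nat \<Rightarrow> real \<Rightarrow> complex" and \<mu> :: "nat \<Rightarrow> real" and B :: real
  assumes mono: "mono \<mu>" and pos: "\<And>j. 0 < \<mu> j" and B: "0 \<le> B"
    and taylor: "\<And>n m t h. n < 2 * m \<Longrightarrow>
      norm (D n (t + h) - (\<Sum>i<2 * m - n. D (n + i) t * of_real h ^ i / fact i))
        \<le> B * (\<Prod>j<2 * m. \<mu> j) * \<bar>h\<bar> ^ (2 * m - n) / fact (2 * m - n)"
begin

text \<open>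
  In the Taylor expansion at \<open>t\<close> up to order \<open>k = 2 m + 2\<close>, the term of index \<open>i\<close> gains a
  factor \<open>e\<^sup>i\<close> from the weights and at most \<open>\<mu> k ^ i\<close> from the products. The terms therefore
  add up to at most \<open>exp (e \<bar>h\<bar> \<mu> k) \<le> e\<^sup>2\<close> times the bound at index 0, which is the loss in the
  conclusion. The remainder has the shape of the missing term \<open>i = k - n\<close>.
\<close>
lemma bang_step:
  assumes small: "\<And>n. n < 2 * Suc m \<Longrightarrow>
      norm (D n t) \<le> B * exp (real n - 2 * real (Suc m)) * (\<Prod>j<n. \<mu> j)"
    and h: "exp 1 * \<bar>h\<bar> * \<mu> (2 * Suc m) \<le> 2" and n: "n < 2 * m"
  shows "norm (D n (t + h)) \<le> B * exp (real n - 2 * real m) * (\<Prod>j<n. \<mu> j)"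
proof -
  define k where "k = 2 * Suc m"
  define z where "z = exp 1 * \<bar>h\<bar> * \<mu> k"
  define c where "c = B * exp (real n - real k) * (\<Prod>j<n. \<mu> j)"
  have nk: "n < k" using n by (simp add: k_def)
  have z: "0 \<le> z" "z \<le> 2"
    using h pos[of k] by (auto simp: z_def k_def)
  have c: "0 \<le> c"
    using B pos by (auto simp: c_def less_imp_le intro!: mult_nonneg_nonneg prod_nonneg)
  have bound: "B * exp (real (n + i) - real k) * (\<Prod>j<n + i. \<mu> j) * \<bar>h\<bar> ^ i / fact i
      \<le> c * (z ^ i / fact i)" if "n + i \<le> k" for i
  proof -
    have e: "exp (real (n + i) - real k) = exp (real n - real k) * exp 1 ^ i"
      by (simp add: algebra_simps flip: exp_of_nat_mult exp_add)
    have "B * exp (real (n + i) - real k) * (\<Prod>j<n + i. \<mu> j) * \<bar>h\<bar> ^ i / fact i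
        \<le> B * exp (real (n + i) - real k) * ((\<Prod>j<n. \<mu> j) * \<mu> k ^ i) * \<bar>h\<bar> ^ i / fact i"
      using B that by (intro divide_right_mono mult_right_mono mult_left_mono
          prod_nondecreasing_split_le mono pos) auto
    also have "\<dots> = c * (z ^ i / fact i)"
      unfolding e by (simp add: c_def z_def power_mult_distrib mult_ac)
    finally show ?thesis .
  qed
  let ?S = "\<Sum>i<k - n. D (n + i) t * of_real h ^ i / fact i"
  have "norm (D n (t + h) - ?S) \<le> c * (z ^ (k - n) / fact (k - n))"
    using taylor[of n "Suc m" t h] bound[of "k - n"] nk by (simp add: k_def)
  moreover have "norm ?S \<le> (\<Sum>i<k - n. c * (z ^ i / fact i))"
  proof (intro sum_norm_le)
    fix i assume i: "i \<in> {..<k - n}"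
    have "norm (D (n + i) t * of_real h ^ i / fact i)
        \<le> B * exp (real (n + i) - real k) * (\<Prod>j<n + i. \<mu> j) * \<bar>h\<bar> ^ i / fact i"
      using small[of "n + i"] i
      by (auto simp: norm_mult norm_divide norm_power k_def
          intro!: divide_right_mono mult_right_mono)
    also have "\<dots> \<le> c * (z ^ i / fact i)"
      using bound[of i] i by simp
    finally show "norm (D (n + i) t * of_real h ^ i / fact i) \<le> c * (z ^ i / fact i)" .
  qed
  ultimately have "norm (D n (t + h))
      \<le> c * (z ^ (k - n) / fact (k - n)) + (\<Sum>i<k - n. c * (z ^ i / fact i))"
    using norm_triangle_sub[of "D n (t + h)" ?S] by linarith
  also have "\<dots> = c * (\<Sum>i\<le>k - n. z ^ i / fact i)"
    by (simp add: sum_distrib_left distrib_left flip: lessThan_Suc_atMost)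
  also have "\<dots> \<le> c * exp 2"
    using exp_partial_sum_le[OF z(1), of "k - n"] z(2) c
    by (intro mult_left_mono) (auto intro: order_trans)
  also have "\<dots> = B * (exp (real n - real k) * exp 2) * (\<Prod>j<n. \<mu> j)"
    by (simp add: c_def mult_ac)
  also have "exp (real n - real k) * exp 2 = exp (real n - 2 * real m)"
    by (simp add: k_def flip: exp_add)
  finally show ?thesis .
qed

text \<open>
  Starting from a level \<open>m + d\<close> at the origin, where every bound holds trivially, \<open>d\<close> steps of
  the permitted lengths lead down to level \<open>m\<close>.
\<close>
lemma bang_iterate:
  assumes flat: "\<And>n. D n 0 = 0"
    and "\<bar>t\<bar> \<le> (\<Sum>i<d. 2 / (exp 1 * \<mu> (2 * Suc (m + i))))" and "n < 2 * m"
  shows "norm (D n t) \<le> B * exp (real n - 2 * real m) * (\<Prod>j<n. \<mu> j)"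
  using assms(2,3)
proof (induction d arbitrary: m n t)
  case 0
  then have "norm (D n t) = 0" using flat by simp
  then show ?case
    using B pos by (auto simp: less_imp_le intro!: mult_nonneg_nonneg prod_nonneg)
next
  case (Suc d)
  define r where "r = 2 / (exp 1 * \<mu> (2 * Suc m))"
  define R where "R = (\<Sum>i<d. 2 / (exp 1 * \<mu> (2 * Suc (Suc m + i))))"
  have r: "0 < r" and R: "0 \<le> R"
    using pos by (auto simp: r_def R_def less_imp_le intro!: sum_nonneg)
  have "\<bar>t\<bar> \<le> r + R"
    using Suc.prems(1) by (simp add: r_def R_def sum.lessThan_Suc_shift del: sum.lessThan_Suc)
  \<comment> \<open>The last step on the way from 0 to \<open>t\<close>: the projection of \<open>t\<close> to \<open>[- r, r]\<close>.\<close>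
  define h where "h = max (- r) (min r t)"
  have h: "\<bar>h\<bar> \<le> r" "\<bar>t - h\<bar> \<le> R"
    using r R \<open>\<bar>t\<bar> \<le> r + R\<close> by (auto simp: h_def)
  have "norm (D n (t - h + h)) \<le> B * exp (real n - 2 * real m) * (\<Prod>j<n. \<mu> j)"
  proof (rule bang_step)
    fix n' assume "n' < 2 * Suc m"
    then show "norm (D n' (t - h)) \<le> B * exp (real n' - 2 * real (Suc m)) * (\<Prod>j<n'. \<mu> j)"
      using Suc.IH[of "t - h" "Suc m" n'] h(2) by (simp add: R_def)
  next
    show "exp 1 * \<bar>h\<bar> * \<mu> (2 * Suc m) \<le> 2"
      using h(1) pos[of "2 * Suc m"] by (simp add: r_def field_simps)
  qed (use Suc.prems in simp)
  then show ?case by simp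
qed

text \<open>
  Since the step lengths have a divergent sum, \<open>t\<close> can be reached from the origin down to any
  prescribed level \<open>m\<close>, whatever that level is; the resulting bound \<open>B e\<^sup>-\<^sup>2\<^sup>m\<close> tends to 0.
\<close>
lemma quasi_analytic:
  assumes flat: "\<And>n. D n 0 = 0" and div: "\<not> summable (\<lambda>m. 1 / \<mu> (2 * m))"
  shows "D 0 t = 0"
proof -
  have le: "norm (D 0 t) \<le> B * exp (- 2 * real m)" if "0 < m" for m
  proof -
    let ?f = "\<lambda>i. 2 / (exp 1 * \<mu> (2 * Suc (m + i)))"
    have "\<not> summable ?f"
    proof
      assume "summable ?f"
      then have "summable (\<lambda>i. exp 1 / 2 * ?f i)"
        by (rule summable_mult)
      then have "summable (\<lambda>i. 1 / \<mu> (2 * (i + Suc m)))"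
        by (simp add: add_ac)
      then show False
        using div summable_iff_shift[of "\<lambda>i. 1 / \<mu> (2 * i)" "Suc m"] by simp
    qed
    then have "\<exists>d. \<bar>t\<bar> < (\<Sum>i<d. ?f i)"
      using pos by (meson summableI_nonneg_bounded less_imp_le divide_pos_pos mult_pos_pos
          exp_gt_zero zero_less_numeral not_le)
    then obtain d where "\<bar>t\<bar> \<le> (\<Sum>i<d. ?f i)"
      using less_imp_le by blast
    from bang_iterate[OF flat this, of 0] that show ?thesis by simp
  qed
  have "(\<lambda>m. B * exp (- 2 * real m)) \<longlonglongrightarrow> 0"
    by real_asymp
  then have "norm (D 0 t) \<le> 0"
    using le by (intro tendsto_lowerbound[of _ 0]) (auto intro: eventually_sequentiallyI[of 1])
  then show ?thesis by simp
qed

end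

section \<open>Determinacy on the line from the growth of the even moments\<close>

text \<open>
  This is the derivative of order \<open>n\<close> of the characteristic function. Taking the integral as the
  definition makes differentiation under the integral sign unnecessary, as the Taylor estimate
  follows by integrating the one for the exponential.
\<close>
definition char_deriv :: "real measure \<Rightarrow> nat \<Rightarrow> real \<Rightarrow> complex" where
  "char_deriv P n t = (\<integral>x. (\<i> * of_real x) ^ n * iexp (t * x) \<partial>P)"

lemma integrable_char_deriv:
  assumes [measurable_cong]: "sets P = sets borel" and "integrable P (\<lambda>x. x ^ n)"
  shows "integrable P (\<lambda>x. (\<i> * complex_of_real x) ^ n * iexp (t * x))"
proof (rule Bochner_Integration.integrable_bound[OF assms(2)])
  show "(\<lambda>x. (\<i> * complex_of_real x) ^ n * iexp (t * x)) \<in> borel_measurable P"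
    by measurable
qed (simp add: norm_mult norm_power power_abs)

lemma char_deriv_taylor:
  assumes [measurable_cong]: "sets P = sets borel" 
    and mom: "\<And>n. integrable P (\<lambda>x. x ^ n)" and "n < 2 * m"
  shows "norm (char_deriv P n (t + h) -
      (\<Sum>i<2 * m - n. char_deriv P (n + i) t * of_real h ^ i / fact i))
    \<le> \<bar>h\<bar> ^ (2 * m - n) / fact (2 * m - n) * (\<integral>x. x ^ (2 * m) \<partial>P)"
proof -
  define k where "k = 2 * m - n"
  have k: "0 < k" "n + k = 2 * m" using assms by (auto simp: k_def)
  define F where "F n t x = (\<i> * complex_of_real x) ^ n * iexp (t * x)" for n t x
  have intF[intro]: "integrable P (F n t)" for n t
    unfolding F_def by (intro integrable_char_deriv assms(1) mom)
  have "char_deriv P n (t + h) - (\<Sum>i<k. char_deriv P (n + i) t * of_real h ^ i / fact i)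
      = (\<integral>x. F n (t + h) x - (\<Sum>i<k. F (n + i) t x * of_real h ^ i / fact i) \<partial>P)"
    unfolding char_deriv_def F_def[symmetric]
    by (simp add: Bochner_Integration.integral_diff Bochner_Integration.integral_sum intF)
  also have "norm \<dots> \<le> (\<integral>x. \<bar>h\<bar> ^ k / fact k * x ^ (2 * m) \<partial>P)"
  proof (rule Bochner_Integration.integral_norm_bound_integral)
    show "integrable P (\<lambda>x. F n (t + h) x - (\<Sum>i<k. F (n + i) t x * of_real h ^ i / fact i))"
      by (intro Bochner_Integration.integrable_diff Bochner_Integration.integrable_sum
          integrable_divide integrable_mult_left intF)
    show "integrable P (\<lambda>x. \<bar>h\<bar> ^ k / fact k * x ^ (2 * m))"
      using mom by auto
    fix x
    have "F n (t + h) x - (\<Sum>i<k. F (n + i) t x * of_real h ^ i / fact i)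
      = F n t x * (iexp (h * x) - (\<Sum>i\<le>k - 1. (\<i> * of_real (h * x)) ^ i / fact i))"
    proof -
      have "F n (t + h) x = F n t x * iexp (h * x)"
        by (simp add: F_def ring_distribs exp_add)
      moreover have "F (n + i) t x * of_real h ^ i / fact i
          = F n t x * ((\<i> * of_real (h * x)) ^ i / fact i)" for i
        by (simp add: F_def power_add power_mult_distrib)
      moreover have "{..<k} = {..k - 1}" using k by auto
      ultimately show ?thesis
        by (simp add: right_diff_distrib sum_distrib_left)
    qed
    also have "norm \<dots> \<le> \<bar>x\<bar> ^ n * (\<bar>h * x\<bar> ^ k / fact k)"
      using mult_left_mono[OF iexp_approx1[of "h * x" "k - 1"], of "\<bar>x\<bar> ^ n"] k
      by (simp add: norm_mult norm_power F_def)
    also have "\<dots> = \<bar>h\<bar> ^ k / fact k * \<bar>x\<bar> ^ (n + k)"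
      by (simp add: abs_mult power_mult_distrib power_add)
    also have "\<bar>x\<bar> ^ (n + k) = x ^ (2 * m)"
      using k by (simp add: power_even_abs)
    finally show "norm (F n (t + h) x - (\<Sum>i<k. F (n + i) t x * of_real h ^ i / fact i))
        \<le> \<bar>h\<bar> ^ k / fact k * x ^ (2 * m)" .
  qed
  finally show ?thesis by (simp add: k_def)
qed

text \<open>
  A form of Carleman's criterion on the line. The majorant of the moments is given as a product of
  monotone factors, which is what Bang's argument consumes. Carleman's usual series over
  the roots of the moments is replaced by the series over the reciprocal factors.
\<close>
theorem hamburger_determinacy:
  fixes P Q :: "real measure" and \<mu> :: "nat \<Rightarrow> real"
  assumes P: "real_distribution P" and Q: "real_distribution Q"
    and intP: "\<And>n. integrable P (\<lambda>x. x ^ n)" and intQ: "\<And>n. integrable Q (\<lambda>x. x ^ n)"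
    and eq: "\<And>n. (\<integral>x. x ^ n \<partial>P) = (\<integral>x. x ^ n \<partial>Q)"
    and "mono \<mu>" and pos: "\<And>j. 0 < \<mu> j"
    and bound: "\<And>m. (\<integral>x. x ^ (2 * m) \<partial>Q) \<le> A * (\<Prod>j<2 * m. \<mu> j)"
    and div: "\<not> summable (\<lambda>m. 1 / \<mu> (2 * m))"
  shows "P = Q"
proof -
  interpret P: real_distribution P by fact
  interpret Q: real_distribution Q by fact
  define D where "D n t = char_deriv P n t - char_deriv Q n t" for n t
  have A: "0 \<le> A" using bound[of 0] Q.prob_space by simp
  interpret taylor_family D \<mu> "2 * A"
  proof
    fix n m :: nat and t h :: real
    assume n: "n < 2 * m"
    let ?T = "\<lambda>R. char_deriv R n (t + h) -
      (\<Sum>i<2 * m - n. char_deriv R (n + i) t * of_real h ^ i / fact i)"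
    let ?c = "\<bar>h\<bar> ^ (2 * m - n) / fact (2 * m - n)"
    have "D n (t + h) - (\<Sum>i<2 * m - n. D (n + i) t * of_real h ^ i / fact i) = ?T P - ?T Q"
      by (simp add: D_def ring_distribs diff_divide_distrib sum_subtractf)
    also have "norm \<dots> \<le> norm (?T P) + norm (?T Q)"
      by (rule norm_triangle_ineq4)
    also have "\<dots> \<le> ?c * (A * (\<Prod>j<2 * m. \<mu> j)) + ?c * (A * (\<Prod>j<2 * m. \<mu> j))"
      using bound[of m] eq[of "2 * m"]
      by (intro add_mono order_trans[OF char_deriv_taylor] mult_left_mono intP intQ n) auto
    finally show "norm (D n (t + h) - (\<Sum>i<2 * m - n. D (n + i) t * of_real h ^ i / fact i))
        \<le> 2 * A * (\<Prod>j<2 * m. \<mu> j) * \<bar>h\<bar> ^ (2 * m - n) / fact (2 * m - n)"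
      by (simp add: mult_ac)
  qed (use \<open>mono \<mu>\<close> pos A in auto)
  have "D n 0 = 0" for n
  proof -
    have "char_deriv R n 0 = \<i> ^ n * of_real (\<integral>x. x ^ n \<partial>R)" for R
      by (simp add: char_deriv_def power_mult_distrib
          flip: of_real_power integral_complex_of_real)
    then show ?thesis by (simp add: D_def eq)
  qed
  then have "D 0 t = 0" for t
    using div by (rule quasi_analytic)
  then have "char P = char Q"
    by (auto simp: D_def char_deriv_def char_def fun_eq_iff)
  then show ?thesis
    using Levy_uniqueness P Q by blast
qed

section \<open>Symmetrisation of laws on the half-line\<close>

text \<open>
  The absolute value makes the square of the random variable equal to \<open>\<bar>x\<bar>\<close> for every real \<open>x\<close>, so
  that negligible sets play a role only for the law \<open>N\<close> itself and not on the product space.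
\<close>
definition random_sign_sqrt :: "real measure \<Rightarrow> real measure" where
  "random_sign_sqrt N = distr (N \<Otimes>\<^sub>M measure_pmf (bernoulli_pmf (1 / 2))) borel
     (\<lambda>(x, b). (if b then 1 else - 1) * sqrt \<bar>x\<bar>)"

locale nonneg_distribution = real_distribution N for N +
  assumes nonneg: "AE x in N. 0 \<le> x"
begin

abbreviation coin :: "bool measure" where
  "coin \<equiv> measure_pmf (bernoulli_pmf (1 / 2))"

sublocale pair: pair_prob_space N coin
  by unfold_locales

lemma measurable_signed_sqrt [measurable]:
  "(\<lambda>(x, b). (if b then 1 else - 1) * sqrt \<bar>x\<bar>) \<in> borel_measurable (N \<Otimes>\<^sub>M coin)"
  by measurable

lemma real_distribution_random_sign_sqrt: "real_distribution (random_sign_sqrt N)"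
  unfolding random_sign_sqrt_def
  by (intro real_distribution.intro real_distribution_axioms.intro pair.prob_space_distr
      measurable_signed_sqrt) simp_all

lemma square_random_sign_sqrt: "distr (random_sign_sqrt N) borel (\<lambda>x. x\<^sup>2) = N"
proof -
  have "distr (random_sign_sqrt N) borel (\<lambda>x. x\<^sup>2) = distr (N \<Otimes>\<^sub>M coin) borel (\<lambda>z. \<bar>fst z\<bar>)"
    unfolding random_sign_sqrt_def
    by (subst distr_distr) (auto intro!: distr_cong simp: power_mult_distrib split_beta)
  also have "\<dots> = distr (distr (N \<Otimes>\<^sub>M coin) N fst) borel abs"
    by (subst distr_distr) (auto simp: o_def)
  also have "distr (N \<Otimes>\<^sub>M coin) N fst = N"
    by (rule prob_space.distr_pair_fst[OF measure_pmf.prob_space_axioms])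
  also have "distr N borel abs = distr N borel (\<lambda>x. x)"
    using nonneg by (intro distr_cong_AE) auto
  also have "\<dots> = N"
    by (rule distr_id2) simp
  finally show ?thesis .
qed

lemma
  assumes int: "\<And>n. integrable N (\<lambda>x. x ^ n)"
  shows integrable_random_sign_sqrt: "integrable (random_sign_sqrt N) (\<lambda>x. x ^ n)"
    and moment_random_sign_sqrt: "(\<integral>x. x ^ n \<partial>random_sign_sqrt N)
      = (if even n then \<integral>x. x ^ (n div 2) \<partial>N else 0)"
proof -
  let ?f = "\<lambda>(x, b). (if b then 1 else - 1) * sqrt \<bar>x\<bar>"
  \<comment> \<open>Half-integer powers are dominated by 1 plus an integer power.\<close>
  have sqrt_int: "integrable N (\<lambda>x. sqrt \<bar>x\<bar> ^ n)"
  proof (rule Bochner_Integration.integrable_bound)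
    show "integrable N (\<lambda>x. 1 + x ^ n)" by (intro Bochner_Integration.integrable_add int) simp
    show "AE x in N. norm (sqrt \<bar>x\<bar> ^ n) \<le> norm (1 + x ^ n)"
      using nonneg
    proof eventually_elim
      fix x :: real assume x: "0 \<le> x"
      have "sqrt x ^ n \<le> 1 + x ^ n"
      proof (cases "x \<le> 1")
        case True
        then have "sqrt x ^ n \<le> 1" using x by (intro power_le_one) auto
        then show ?thesis using x by (simp add: add_increasing2)
      next
        case False
        then have "sqrt x ^ n \<le> x ^ n"
          by (intro power_mono real_le_lsqrt) (auto simp: power2_eq_square)
        then show ?thesis by simp
      qed
      then show "norm (sqrt \<bar>x\<bar> ^ n) \<le> norm (1 + x ^ n)" using x by simp
    qed
  qed simp
  have "integrable (distr (N \<Otimes>\<^sub>M coin) N fst) (\<lambda>x. sqrt \<bar>x\<bar> ^ n)"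
    using sqrt_int by (simp add: prob_space.distr_pair_fst[OF measure_pmf.prob_space_axioms])
  then have "integrable (N \<Otimes>\<^sub>M coin) (\<lambda>z. sqrt \<bar>fst z\<bar> ^ n)"
    by (subst (asm) integrable_distr_eq) auto
  then have int2: "integrable (N \<Otimes>\<^sub>M coin) (\<lambda>z. ?f z ^ n)"
    by (rule Bochner_Integration.integrable_bound) (auto simp: abs_mult power_abs split_beta)
  then show "integrable (random_sign_sqrt N) (\<lambda>x. x ^ n)"
    unfolding random_sign_sqrt_def by (subst integrable_distr_eq) auto
  have "(\<integral>x. x ^ n \<partial>random_sign_sqrt N) = (\<integral>z. ?f z ^ n \<partial>(N \<Otimes>\<^sub>M coin))"
    unfolding random_sign_sqrt_def by (subst integral_distr) auto
  also have "\<dots> = (\<integral>x. (\<integral>b. ?f (x, b) ^ n \<partial>coin) \<partial>N)"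
    using int2 by (rule pair.integral_fst'[symmetric])
  also have "\<dots> = (\<integral>x. (if even n then \<bar>x\<bar> ^ (n div 2) else 0) \<partial>N)"
    by (intro Bochner_Integration.integral_cong refl)
       (auto simp: power_mult_distrib power_mult elim!: evenE)
  also have "\<dots> = (if even n then \<integral>x. x ^ (n div 2) \<partial>N else 0)"
    using nonneg by (auto intro!: integral_cong_AE)
  finally show "(\<integral>x. x ^ n \<partial>random_sign_sqrt N)
      = (if even n then \<integral>x. x ^ (n div 2) \<partial>N else 0)" .
qed

end

section \<open>The growth scale n log n\<close>

text \<open>
  The shift by 2 keeps all values at least 1, so that no small index needs separate treatment.
\<close>
definition nlogn :: "nat \<Rightarrow> real" where
  "nlogn n = (real n + 2) * ln (real n + 2)"

lemma half_le_ln_two: "1 / 2 \<le> ln (2 :: real)"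
  using ln2_ge_two_thirds by simp

lemma nlogn_ge_one: "1 \<le> nlogn n"
proof -
  have "2 * (1 / 2) \<le> (real n + 2) * ln (real n + 2)"
    by (intro mult_mono order_trans[OF half_le_ln_two]) auto
  then show ?thesis by (simp add: nlogn_def)
qed

text \<open>
  The ratio of consecutive terms is \<open>1 + O(1 / n)\<close>; its \<open>n\<close>-th power is thus bounded, which is
  what the comparison with products below requires.
\<close>
lemma nlogn_Suc_le: "nlogn (Suc n) \<le> exp (3 / (real n + 2)) * nlogn n"
proof -
  define x where "x = real n + 2"
  have x: "2 \<le> x" by (simp add: x_def)
  have l: "1 / 2 \<le> ln x"
    using half_le_ln_two x by (auto intro: order_trans)
  have "ln (x + 1) - ln x = ln (1 + 1 / x)"
    using x ln_div[of "x + 1" x] by (simp add: add_divide_distrib)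
  also have "\<dots> \<le> 1 / x"
    using x by (intro ln_add_one_self_le_self) auto
  also have "\<dots> \<le> 2 / x * ln x"
    using l x by (simp add: field_simps)
  finally have "ln (x + 1) \<le> (1 + 2 / x) * ln x"
    by (simp add: field_simps)
  then have "ln (x + 1) \<le> exp (2 / x) * ln x"
    using l exp_ge_add_one_self[of "2 / x"] by (auto intro: order_trans mult_right_mono)
  moreover have "x + 1 = (1 + 1 / x) * x" using x by (simp add: field_simps)
  then have "x + 1 \<le> exp (1 / x) * x"
    using x exp_ge_add_one_self[of "1 / x"] by (metis mult_right_mono order_trans zero_le_numeral)
  ultimately have "(x + 1) * ln (x + 1) \<le> (exp (1 / x) * x) * (exp (2 / x) * ln x)"
    using x by (intro mult_mono) auto
  also have "\<dots> = exp (3 / x) * (x * ln x)"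
    by (simp add: add_divide_distrib[symmetric] flip: exp_add)
  finally show ?thesis
    by (simp add: nlogn_def x_def add_ac)
qed

lemma mono_nlogn: "mono nlogn"
  unfolding nlogn_def by (intro monoI mult_mono) auto

text \<open>
  Powers \<open>b\<^sub>n\<^sup>n\<close> have to be exchanged for products of monotone factors; up to the constant \<open>e\<^sup>3\<close>
  in each factor, the two grow alike.
\<close>
lemma nlogn_power_le_prod:
  "nlogn n ^ n \<le> (\<Prod>j<n. exp 3 * nlogn (Suc j))"
proof (induction n)
  case 0
  then show ?case by simp
next
  case (Suc n)
  have "nlogn (Suc n) ^ n \<le> (exp (3 / (real n + 2)) * nlogn n) ^ n"
    using nlogn_ge_one[of "Suc n"] by (intro power_mono nlogn_Suc_le) auto
  also have "\<dots> = exp (real n * (3 / (real n + 2))) * nlogn n ^ n"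
    by (simp add: power_mult_distrib flip: exp_of_nat_mult)
  also have "\<dots> \<le> exp 3 * (\<Prod>j<n. exp 3 * nlogn (Suc j))"
    using nlogn_ge_one[of n] Suc.IH by (intro mult_mono) (auto simp: field_simps)
  finally have "nlogn (Suc n) ^ n \<le> exp 3 * (\<Prod>j<n. exp 3 * nlogn (Suc j))" .
  then show ?case
    using nlogn_ge_one[of "Suc n"] by (simp add: mult_ac mult_left_mono)
qed

text \<open>
  Up to a constant, the partial sums dominate half of \<open>ln (ln (2 n + 3))\<close>, by telescoping along
  the odd numbers.
\<close>
lemma not_summable_inverse_nlogn: "\<not> summable (\<lambda>m. 1 / nlogn (Suc (2 * m)))"
proof
  assume sum: "summable (\<lambda>m. 1 / nlogn (Suc (2 * m)))"
  have step: "ln (ln (x + 2)) - ln (ln x) \<le> 2 * (1 / (x * ln x))" if x: "3 \<le> x" for x :: real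
  proof -
    have l: "0 < ln x" using x by simp
    have "ln (ln (x + 2)) - ln (ln x) = ln (ln (x + 2) / ln x)"
      using x by (simp add: ln_div)
    also have "\<dots> \<le> ln (x + 2) / ln x - 1"
      using x by (intro ln_le_minus_one) auto
    also have "\<dots> = (ln (x + 2) - ln x) / ln x"
      using l by (simp add: field_simps)
    also have "ln (x + 2) - ln x = ln (1 + 2 / x)"
      using x ln_div[of "x + 2" x] by (simp add: add_divide_distrib)
    also have "ln (1 + 2 / x) \<le> 2 / x"
      using x by (intro ln_add_one_self_le_self) auto
    finally show ?thesis
      using l x by (simp add: divide_right_mono)
  qed
  have lower: "ln (ln (real (2 * n) + 3)) - ln (ln 3) \<le> 2 * (\<Sum>m<n. 1 / nlogn (Suc (2 * m)))" for n
  proof (induction n)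
    case 0
    then show ?case by simp
  next
    case (Suc n)
    have "ln (ln (real (2 * n) + 3 + 2)) - ln (ln (real (2 * n) + 3)) \<le> 2 * (1 / nlogn (Suc (2 * n)))"
      using step[of "real (2 * n) + 3"] by (simp add: nlogn_def add_ac)
    then show ?case
      using Suc.IH by (simp add: add_ac)
  qed
  have upper: "(\<Sum>m<n. 1 / nlogn (Suc (2 * m))) \<le> (\<Sum>m. 1 / nlogn (Suc (2 * m)))" for n
    using nlogn_ge_one by (intro sum_le_suminf[OF sum]) (auto intro: order_trans[OF zero_le_one])
  have le: "ln (ln (real (2 * n) + 3)) \<le> ln (ln 3) + 2 * (\<Sum>m. 1 / nlogn (Suc (2 * m)))" for n
    using lower[of n] upper[of n] by linarith
  have "filterlim (\<lambda>n. ln (ln (2 * real n + 3))) at_top sequentially"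
    by real_asymp
  then have "filterlim (\<lambda>n. ln (ln (real (2 * n) + 3))) at_top sequentially"
    by simp
  then have "eventually (\<lambda>n. ln (ln 3) + 2 * (\<Sum>m. 1 / nlogn (Suc (2 * m)))
      < ln (ln (real (2 * n) + 3))) sequentially"
    unfolding filterlim_at_top_dense by blast
  then obtain N where "ln (ln 3) + 2 * (\<Sum>m. 1 / nlogn (Suc (2 * m))) < ln (ln (real (2 * N) + 3))"
    using eventually_happens'[OF sequentially_bot] by blast
  then show False using le[of N] by simp
qed

text \<open>
  Determines the truncation point \<open>R = K b\<^sub>n\<close> for moments of order \<open>n\<close>: beyond \<open>R\<close>, a shift by
  \<open>c ln x\<close> multiplies \<open>x\<^sup>n\<close> by at most about \<open>exp (n c ln R / R) \<le> exp \<delta>\<close>. It exists because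
  \<open>ln (K b\<^sub>n)\<close> is at most \<open>(2 + 2 ln K) ln (n + 2)\<close>, which is smaller than \<open>K ln (n + 2)\<close> by any
  factor when \<open>K\<close> is large.
\<close>
lemma exists_nlogn_scale:
  fixes c \<delta> r :: real
  assumes "0 < c" "0 < \<delta>" "1 < r"
  obtains K where "1 \<le> K" "r \<le> K"
    "\<And>n. real n * (c * ln (K * nlogn n)) \<le> \<delta> * (K * nlogn n)"
proof -
  have "eventually (\<lambda>K. c * (2 + 2 * ln K) \<le> \<delta> * K) at_top"
    using assms by real_asymp
  then obtain K0 where K0: "\<And>K. K0 \<le> K \<Longrightarrow> c * (2 + 2 * ln K) \<le> \<delta> * K"
    by (auto simp: eventually_at_top_linorder)
  define K where "K = max K0 r"
  have K: "c * (2 + 2 * ln K) \<le> \<delta> * K" "1 < K"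
    using K0 assms by (auto simp: K_def)
  have "real n * (c * ln (K * nlogn n)) \<le> \<delta> * (K * nlogn n)" for n
  proof -
    define x where "x = real n + 2"
    have x: "2 \<le> x" by (simp add: x_def)
    have l: "1 / 2 \<le> ln x" using half_le_ln_two x by (auto intro: order_trans)
    have "ln (K * nlogn n) = ln K + ln x + ln (ln x)"
      using K x l by (simp add: nlogn_def ln_mult flip: x_def)
    also have "\<dots> \<le> (2 + 2 * ln K) * ln x"
    proof -
      have "0 \<le> ln K" using K by simp
      then have "ln K * 1 \<le> ln K * (2 * ln x)" using l by (intro mult_left_mono) auto
      moreover have "ln (ln x) \<le> ln x" using ln_le_minus_one[of "ln x"] l by simp
      ultimately show ?thesis by (simp add: algebra_simps)
    qed
    finally have 1: "ln (K * nlogn n) \<le> (2 + 2 * ln K) * ln x" .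
    have "1 * 1 \<le> K * nlogn n"
      using K nlogn_ge_one[of n] by (intro mult_mono) auto
    then have "real n * (c * ln (K * nlogn n)) \<le> x * (c * ((2 + 2 * ln K) * ln x))"
      using assms 1 by (intro mult_mono) (auto simp: x_def)
    also have "\<dots> = (c * (2 + 2 * ln K)) * (x * ln x)" by (simp add: mult_ac)
    also have "\<dots> \<le> (\<delta> * K) * (x * ln x)"
      using K x by (intro mult_right_mono) auto
    finally show ?thesis by (simp add: nlogn_def x_def mult_ac)
  qed
  then show ?thesis
    using K by (intro that[of K]) (auto simp: K_def)
qed

section \<open>Laws with a density on a half-line\<close>

lemma emeasure_Ioi_eqI:
  fixes M N :: "real measure"
  assumes [simp]: "sets M = sets borel" "sets N = sets borel"
    and eq: "\<And>b. a < b \<Longrightarrow> emeasure M {a<..b} = emeasure N {a<..b}"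
  shows "emeasure M {a<..} = emeasure N {a<..}"
proof -
  have U: "{a<..} = (\<Union>n. {a<..a + real (Suc n)})"
  proof (intro set_eqI iffI)
    fix x assume "x \<in> {a<..}"
    moreover obtain n where "x - a \<le> real n" using real_arch_simple by blast
    ultimately have "x \<in> {a<..a + real (Suc n)}" by auto
    then show "x \<in> (\<Union>n. {a<..a + real (Suc n)})" by blast
  qed auto
  have "emeasure L {a<..} = (SUP n. emeasure L {a<..a + real (Suc n)})"
    if "sets L = sets borel" for L :: "real measure"
    unfolding U
  proof (rule SUP_emeasure_incseq[symmetric])
    show "range (\<lambda>n. {a<..a + real (Suc n)}) \<subseteq> sets L"
      unfolding that by auto
    show "incseq (\<lambda>n. {a<..a + real (Suc n)})"
      unfolding incseq_def by auto
  qed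
  from this[OF assms(1)] this[OF assms(2)] show ?thesis
    using eq by simp
qed

locale eventual_density = real_distribution P for P +
  fixes g :: "real \<Rightarrow> real" and x0 :: real
  assumes dens: "abs_cont_from_with_density (cdf P) x0 g"
    and g_nonneg: "\<And>x. x0 \<le> x \<Longrightarrow> 0 \<le> g x"
begin

text \<open>
  The function \<open>g\<close> is arbitrary on the left of \<open>x0\<close> and need not be measurable there; cutting it off
  gives a Borel function on the whole line.
\<close>
definition tail_density :: "real \<Rightarrow> real" where
  "tail_density x = indicator {x0..} x * g x"

lemma tail_density_nonneg [simp]: "0 \<le> tail_density x"
  using g_nonneg by (auto simp: tail_density_def indicator_def)

lemma tail_density_measurable [measurable]: "tail_density \<in> borel_measurable borel"
proof (rule borel_measurable_LIMSEQ_real)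
  show "(\<lambda>n. indicator {x0..x0 + real n} x * g x) \<longlonglongrightarrow> tail_density x" for x
  proof -
    obtain N where N: "x - x0 \<le> real N" using real_arch_simple by blast
    have "eventually (\<lambda>n. indicator {x0..x0 + real n} x * g x = tail_density x) sequentially"
      using N by (intro eventually_sequentiallyI[of N])
        (auto simp: tail_density_def indicator_def)
    then show ?thesis by (rule tendsto_eventually)
  qed
  show "(\<lambda>x. indicator {x0..x0 + real n} x * g x) \<in> borel_measurable borel" for n
  proof -
    have "set_integrable lborel {x0..x0 + real n} g"
      using dens unfolding abs_cont_from_with_density_def by simp
    then show ?thesis
      by (auto simp: set_integrable_def)
  qed
qed

lemma emeasure_Ioc:
  assumes "x0 \<le> u" "u < v"
  shows "emeasure P {u<..v} = emeasure (density lborel tail_density) {u<..v}"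
proof -
  have int: "set_integrable lborel {x0..x} g"
    and cdf: "cdf P x = cdf P x0 + (LINT y:{x0..x}|lborel. g y)" if "x0 \<le> x" for x
    using dens that unfolding abs_cont_from_with_density_def by blast+
  have int': "set_integrable lborel {u<..v} g"
    using int[of v] assms by (auto intro: set_integrable_subset)
  have "measure P {u<..v} = cdf P v - cdf P u"
    using assms by (simp add: cdf_diff_eq)
  also have "\<dots> = (LINT y:{x0..u} \<union> {u<..v}|lborel. g y) - (LINT y:{x0..u}|lborel. g y)"
    using cdf[of u] cdf[of v] assms by (simp add: ivl_disj_un)
  also have "\<dots> = (LINT y:{u<..v}|lborel. g y)"
    using int[of u] int' assms by (subst set_integral_Un) auto
  also have "ennreal \<dots> = (\<integral>\<^sup>+y. ennreal (indicator {u<..v} y * g y) \<partial>lborel)"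
    using int' g_nonneg assms unfolding set_lebesgue_integral_def set_integrable_def
    by (subst nn_integral_eq_integral) (auto simp: indicator_def)
  also have "\<dots> = (\<integral>\<^sup>+y. ennreal (tail_density y) * indicator {u<..v} y \<partial>lborel)"
    using assms by (intro nn_integral_cong) (auto simp: tail_density_def indicator_def)
  also have "\<dots> = emeasure (density lborel tail_density) {u<..v}"
    by (simp add: emeasure_density)
  finally show ?thesis by (simp add: emeasure_eq_measure)
qed

lemma restrict_tail_eq_density:
  assumes "x0 \<le> r"
  shows "density P (indicator {r<..}) = density (density lborel tail_density) (indicator {r<..})"
proof (rule measure_eqI_lessThan)
  fix x
  have "emeasure P {max r x<..} = emeasure (density lborel tail_density) {max r x<..}"
    using assms by (intro emeasure_Ioi_eqI emeasure_Ioc) auto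
  moreover have *: "emeasure (density L (indicator {r<..})) {x<..} = emeasure L {max r x<..}"
    if "sets L = sets borel" for L :: "real measure"
  proof -
    have "emeasure (density L (indicator {r<..})) {x<..}
        = (\<integral>\<^sup>+y. indicator {r<..} y * indicator {x<..} y \<partial>L)"
      using that by (intro emeasure_density) (auto simp: measurable_def)
    also have "\<dots> = (\<integral>\<^sup>+y. indicator {max r x<..} y \<partial>L)"
      by (intro nn_integral_cong) (auto simp: indicator_def)
    also have "\<dots> = emeasure L {max r x<..}"
      using that by (intro nn_integral_indicator) auto
    finally show ?thesis .
  qed
  ultimately show "emeasure (density P (indicator {r<..})) {x<..} =
      emeasure (density (density lborel tail_density) (indicator {r<..})) {x<..}"
    by simp
  show "emeasure (density P (indicator {r<..})) {x<..} < \<infinity>"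
    using *[of P] by (simp add: less_top[symmetric])
qed simp_all

text \<open>
  The point \<open>r\<close> is excluded on the left because the law may have an atom at \<open>x0\<close>, and included
  on the right because the substitution rule works with closed intervals.
\<close>
lemma nn_integral_tail:
  fixes f :: "real \<Rightarrow> ennreal"
  assumes "x0 \<le> r" and [measurable]: "f \<in> borel_measurable borel"
  shows "(\<integral>\<^sup>+x. f x * indicator {r<..} x \<partial>P)
    = (\<integral>\<^sup>+x. tail_density x * f x * indicator {r..} x \<partial>lborel)"
proof -
  have "(\<integral>\<^sup>+x. f x * indicator {r<..} x \<partial>P) = (\<integral>\<^sup>+x. f x \<partial>density P (indicator {r<..}))"
    by (simp add: nn_integral_density mult.commute)
  also have "\<dots> = (\<integral>\<^sup>+x. tail_density x * (indicator {r<..} x * f x) \<partial>lborel)"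
    unfolding restrict_tail_eq_density[OF assms(1)]
    by (simp add: nn_integral_density)
  also have "\<dots> = (\<integral>\<^sup>+x. tail_density x * f x * indicator {r..} x \<partial>lborel)"
    using AE_lborel_singleton[of r]
    by (intro nn_integral_cong_AE, eventually_elim) (auto simp: indicator_def)
  finally show ?thesis .
qed

text \<open>
  Substituting \<open>y = T x\<close> turns \<open>g(y) dy\<close> into \<open>g(T x) T'(x) dx\<close>, which is at most \<open>q \<kappa> g(x) dx\<close>.
  The substitution rule is available on bounded intervals, so these are exhausted at the end.
\<close>
lemma nn_integral_tail_shift_le:
  fixes T T' \<phi> :: "real \<Rightarrow> real"
  assumes "x0 \<le> r"
    and der: "\<And>x. r \<le> x \<Longrightarrow> (T has_real_derivative T' x) (at x)"
    and cont: "continuous_on {r..} T'"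
    and T': "\<And>x. r \<le> x \<Longrightarrow> 0 \<le> T' x" "\<And>x. r \<le> x \<Longrightarrow> T' x \<le> \<kappa>"
    and T_ge: "\<And>x. r \<le> x \<Longrightarrow> x \<le> T x"
    and contract: "\<And>x. r \<le> x \<Longrightarrow> g (T x) \<le> q * g x" and "0 \<le> q"
    and [measurable]: "T \<in> borel_measurable borel" "\<phi> \<in> borel_measurable borel"
    and \<phi>: "\<And>x. 0 \<le> \<phi> x"
  shows "(\<integral>\<^sup>+x. ennreal (\<phi> x) * indicator {T r<..} x \<partial>P)
    \<le> ennreal (q * \<kappa>) * (\<integral>\<^sup>+x. ennreal (\<phi> (T x)) * indicator {r<..} x \<partial>P)"
proof -
  have \<kappa>: "0 \<le> \<kappa>" using T'[of r] by linarith
  let ?f = "\<lambda>x. tail_density x * \<phi> x"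
  let ?C = "ennreal (q * \<kappa>) * (\<integral>\<^sup>+x. ennreal (\<phi> (T x)) * indicator {r<..} x \<partial>P)"
  have step: "emeasure (density lborel ?f) {T r..T (r + real n)} \<le> ?C" for n
  proof -
    have "emeasure (density lborel ?f) {T r..T (r + real n)}
        = (\<integral>\<^sup>+x. ?f x * indicator {T r..T (r + real n)} x \<partial>lborel)"
      by (auto simp: emeasure_density indicator_def intro!: nn_integral_cong)
    also have "\<dots> = (\<integral>\<^sup>+x. ?f (T x) * T' x * indicator {r..r + real n} x \<partial>lborel)"
      using cont der T' unfolding set_borel_measurable_def
      by (intro nn_integral_substitution) (auto simp: set_borel_measurable_def intro: continuous_on_subset)
    also have "\<dots> \<le> (\<integral>\<^sup>+x. ennreal (q * \<kappa>) *
        (tail_density x * ennreal (\<phi> (T x)) * indicator {r..} x) \<partial>lborel)"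
    proof (intro nn_integral_mono)
      fix x
      show "ennreal (?f (T x) * T' x * indicator {r..r + real n} x)
        \<le> ennreal (q * \<kappa>) * (tail_density x * ennreal (\<phi> (T x)) * indicator {r..} x)"
      proof (cases "x \<in> {r..r + real n}")
        case True
        then have x: "r \<le> x" "x0 \<le> x" "x0 \<le> T x" using assms(1) T_ge[of x] by auto
        have "g (T x) * T' x \<le> (q * g x) * \<kappa>"
          using contract x T' g_nonneg \<open>0 \<le> q\<close> by (intro mult_mono) auto
        then have "(g (T x) * T' x) * \<phi> (T x) \<le> ((q * g x) * \<kappa>) * \<phi> (T x)"
          using \<phi> by (rule mult_right_mono)
        then have "?f (T x) * T' x \<le> q * \<kappa> * (tail_density x * \<phi> (T x))"
          using x by (simp add: tail_density_def mult_ac)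
        then show ?thesis
          using True x \<kappa> \<open>0 \<le> q\<close> \<phi> by (simp add: ennreal_mult'[symmetric] ennreal_leI)
      qed (simp add: indicator_def)
    qed
    also have "\<dots> = ?C"
      using nn_integral_tail[OF assms(1), of "\<lambda>x. ennreal (\<phi> (T x))"]
      by (simp add: nn_integral_cmult)
    finally show ?thesis .
  qed
  have mono_T: "T x \<le> T y" if "r \<le> x" "x \<le> y" for x y
    using that by (intro deriv_nonneg_imp_mono[where g = T and g' = T'] der T') auto
  have "T r \<ge> x0" using T_ge[of r] assms(1) by simp
  then have "(\<integral>\<^sup>+x. ennreal (\<phi> x) * indicator {T r<..} x \<partial>P)
      = (\<integral>\<^sup>+x. tail_density x * ennreal (\<phi> x) * indicator {T r..} x \<partial>lborel)"
    by (intro nn_integral_tail) simp_all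
  also have "\<dots> = emeasure (density lborel ?f) {T r..}"
    by (simp add: emeasure_density ennreal_mult')
  also have "{T r..} = (\<Union>n. {T r..T (r + real n)})"
  proof (intro set_eqI iffI)
    fix x assume "x \<in> {T r..}"
    moreover obtain n where "x - r \<le> real n" using real_arch_simple by blast
    then have "x \<le> T (r + real n)" using T_ge[of "r + real n"] by simp
    ultimately show "x \<in> (\<Union>n. {T r..T (r + real n)})" by auto
  qed auto
  also have "emeasure (density lborel ?f) \<dots> = (SUP n. emeasure (density lborel ?f) {T r..T (r + real n)})"
    by (intro SUP_emeasure_incseq[symmetric])
       (auto simp: incseq_def intro: order_trans mono_T)
  also have "\<dots> \<le> ?C"
    using step by (intro SUP_least) simp
  finally show ?thesis .
qed

end

section \<open>Moment growth from contraction of the tail\<close>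

text \<open>
  Here \<open>(1 + c ln x / x)\<^sup>n \<le> exp (n c ln x / x)\<close>, and \<open>ln x / x\<close> decreases from \<open>e\<close> onwards, so
  that the condition at \<open>R\<close> persists for all larger \<open>x\<close>.
\<close>
lemma exp_power_shift_le:
  fixes x R c \<delta> :: real
  assumes "exp 1 \<le> R" "R \<le> x" "0 \<le> c" and R: "real n * (c * ln R) \<le> \<delta> * R"
  shows "(x + c * ln x) ^ n \<le> exp \<delta> * x ^ n"
proof -
  have "0 < exp (1 :: real)" by simp
  then have pos: "0 < R" "0 < x" using assms by linarith+
  have "1 \<le> ln x" using assms pos by (subst ln_ge_iff) auto
  have "ln x / x \<le> ln R / R"
    using assms by (intro ln_x_over_x_mono)
  then have "real n * c * (ln x / x) \<le> real n * c * (ln R / R)"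
    using assms by (intro mult_left_mono) auto
  also have "\<dots> \<le> \<delta>"
    using R pos by (simp add: field_simps)
  finally have le: "real n * (c * ln x / x) \<le> \<delta>" by (simp add: mult_ac)
  have "(x + c * ln x) ^ n = (1 + c * ln x / x) ^ n * x ^ n"
    using pos by (simp add: field_simps flip: power_mult_distrib)
  also have "\<dots> \<le> exp (c * ln x / x) ^ n * x ^ n"
  proof -
    have "0 \<le> c * ln x / x"
      using pos(2) assms(3) \<open>1 \<le> ln x\<close> by (intro divide_nonneg_pos mult_nonneg_nonneg) linarith+
    then show ?thesis
      using pos by (intro mult_right_mono power_mono exp_ge_add_one_self) auto
  qed
  also have "\<dots> \<le> exp \<delta> * x ^ n"
    using le pos by (intro mult_right_mono) (auto simp flip: exp_of_nat_mult)
  finally show ?thesis .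
qed

context nonneg_distribution
begin

text \<open>
  The moment \<open>e\<close> of order \<open>n\<close> is at most \<open>(T r)\<^sup>n\<close> plus its part above \<open>T r\<close>; by contraction that
  part is at most \<open>\<rho> E[(T Y)\<^sup>n; Y > r]\<close>. Up to \<open>R = K b\<^sub>n\<close> the integrand is at most \<open>(T R)\<^sup>n\<close>, above
  \<open>R\<close> it is at most \<open>exp \<delta> Y\<^sup>n\<close>. This gives \<open>e \<le> (T r)\<^sup>n + \<rho> (T R)\<^sup>n + \<rho> exp \<delta> e\<close>, where the last
  term can be absorbed since \<open>\<rho> exp \<delta> < 1\<close> and \<open>e\<close> is finite.
\<close>
lemma moment_growth_of_tail_contraction:
  fixes T :: "real \<Rightarrow> real" and \<rho> c r :: real
  assumes int: "\<And>n. integrable N (\<lambda>x. x ^ n)"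
    and r: "exp 1 \<le> r" and T_mono: "\<And>x y. r \<le> x \<Longrightarrow> x \<le> y \<Longrightarrow> T x \<le> T y"
    and T: "\<And>x. r \<le> x \<Longrightarrow> x \<le> T x" "\<And>x. r \<le> x \<Longrightarrow> T x \<le> x + c * ln x"
    and [measurable]: "T \<in> borel_measurable borel"
    and \<rho>: "0 < \<rho>" "\<rho> < 1" and "0 < c"
    and contract: "\<And>n. (\<integral>\<^sup>+x. ennreal (\<bar>x\<bar> ^ n) * indicator {T r<..} x \<partial>N)
      \<le> ennreal \<rho> * (\<integral>\<^sup>+x. ennreal (\<bar>T x\<bar> ^ n) * indicator {r<..} x \<partial>N)"
  obtains A C where "0 < C" "\<And>n. (\<integral>x. x ^ n \<partial>N) \<le> A * (C * nlogn n) ^ n"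
proof -
  \<comment> \<open>Chosen so that \<open>\<rho> exp \<delta>\<close> is the midpoint of \<open>\<rho>\<close> and 1.\<close>
  define \<delta> where "\<delta> = ln ((1 + \<rho>) / (2 * \<rho>))"
  have \<delta>: "0 < \<delta>" "\<rho> * exp \<delta> = (1 + \<rho>) / 2"
    using \<rho> by (auto simp: \<delta>_def field_simps)
  have "1 < r" using r exp_gt_one[of "1::real"] by linarith
  obtain K where K: "1 \<le> K" "r \<le> K"
    "\<And>n. real n * (c * ln (K * nlogn n)) \<le> \<delta> * (K * nlogn n)"
    using exists_nlogn_scale[OF \<open>0 < c\<close> \<delta>(1) \<open>1 < r\<close>] by blast
  define A where "A = 4 / (1 - \<rho>)"
  define C where "C = (1 + c) * K"
  have "(\<integral>x. x ^ n \<partial>N) \<le> A * (C * nlogn n) ^ n" for n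
  proof -
    define R where "R = K * nlogn n"
    have "K * 1 \<le> K * nlogn n"
      using K nlogn_ge_one by (intro mult_left_mono) auto
    then have R: "r \<le> R" using K(2) by (simp only: R_def mult_1_right)
    have pos: "0 < r" "0 < R" "0 < T r" "0 < T R"
      using R \<open>1 < r\<close> T(1)[of r] T(1)[of R] by linarith+
    have "T R \<le> R + c * R"
      using T(2)[of R] R ln_le_minus_one[of R] pos \<open>0 < c\<close>
      by (smt (verit) mult_left_mono)
    then have TR: "T R \<le> C * nlogn n" by (simp add: C_def R_def algebra_simps)
    define e where "e = (\<integral>x. \<bar>x\<bar> ^ n \<partial>N)"
    have int_abs: "integrable N (\<lambda>x. \<bar>x\<bar> ^ n)"
      using int[of n] by (simp add: power_abs[symmetric])
    have e: "(\<integral>\<^sup>+x. ennreal (\<bar>x\<bar> ^ n) \<partial>N) = ennreal e" "0 \<le> e"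
      unfolding e_def using int_abs by (auto intro: nn_integral_eq_integral)
    have N1 [simp]: "emeasure N UNIV = 1" using emeasure_space_1 by simp
    have "(\<integral>\<^sup>+x. ennreal (\<bar>T x\<bar> ^ n) * indicator {r<..} x \<partial>N)
        \<le> (\<integral>\<^sup>+x. ennreal (T R ^ n) + ennreal (exp \<delta>) * ennreal (\<bar>x\<bar> ^ n) \<partial>N)"
    proof (rule nn_integral_mono)
      fix x
      consider "x \<le> r" | "r < x" "x \<le> R" | "R < x" by linarith
      then show "ennreal (\<bar>T x\<bar> ^ n) * indicator {r<..} x
          \<le> ennreal (T R ^ n) + ennreal (exp \<delta>) * ennreal (\<bar>x\<bar> ^ n)"
      proof cases
        case 2
        then have "\<bar>T x\<bar> ^ n \<le> T R ^ n"
          using T(1)[of x] T_mono[of x R] pos by (intro power_mono) auto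
        then show ?thesis using 2 by (simp add: add_increasing2 ennreal_leI)
      next
        case 3
        then have "\<bar>T x\<bar> ^ n \<le> (x + c * ln x) ^ n"
          using T[of x] R pos by (intro power_mono) auto
        also have "\<dots> \<le> exp \<delta> * x ^ n"
          using R r 3 \<open>0 < c\<close> K(3)[of n] by (intro exp_power_shift_le[of R]) (auto simp: R_def)
        finally show ?thesis
          using 3 R pos by (simp add: add_increasing ennreal_leI flip: ennreal_mult')
      qed simp
    qed
    also have "\<dots> = ennreal (T R ^ n) + ennreal (exp \<delta>) * ennreal e"
      by (simp add: nn_integral_add nn_integral_cmult e(1))
    finally have shifted: "(\<integral>\<^sup>+x. ennreal (\<bar>T x\<bar> ^ n) * indicator {r<..} x \<partial>N)
        \<le> ennreal (T R ^ n) + ennreal (exp \<delta>) * ennreal e" .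
    have "ennreal e \<le> (\<integral>\<^sup>+x. ennreal (T r ^ n) + ennreal (\<bar>x\<bar> ^ n) * indicator {T r<..} x \<partial>N)"
      unfolding e(1)[symmetric]
    proof (rule nn_integral_mono_AE, use nonneg in eventually_elim)
      fix x :: real assume "0 \<le> x"
      then show "ennreal (\<bar>x\<bar> ^ n) \<le> ennreal (T r ^ n) + ennreal (\<bar>x\<bar> ^ n) * indicator {T r<..} x"
        by (cases "x \<le> T r") (auto intro!: ennreal_leI power_mono)
    qed
    also have "\<dots> = ennreal (T r ^ n) + (\<integral>\<^sup>+x. ennreal (\<bar>x\<bar> ^ n) * indicator {T r<..} x \<partial>N)"
      by (simp add: nn_integral_add)
    also have "\<dots> \<le> ennreal (T r ^ n)
        + ennreal \<rho> * (\<integral>\<^sup>+x. ennreal (\<bar>T x\<bar> ^ n) * indicator {r<..} x \<partial>N)"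
      by (intro add_left_mono contract)
    also have "\<dots> \<le> ennreal (T r ^ n)
        + ennreal \<rho> * (ennreal (T R ^ n) + ennreal (exp \<delta>) * ennreal e)"
      by (intro add_left_mono mult_left_mono shifted) simp
    finally have "ennreal e \<le> ennreal (T r ^ n + \<rho> * (T R ^ n + exp \<delta> * e))"
      using pos \<rho> e(2) by (simp add: ennreal_mult ennreal_plus)
    then have "e \<le> T r ^ n + \<rho> * (T R ^ n + exp \<delta> * e)"
      using pos \<rho> e(2) by (subst (asm) ennreal_le_iff) auto
    also have "\<dots> \<le> T R ^ n + (1 * T R ^ n + (\<rho> * exp \<delta>) * e)"
    proof -
      have "T r ^ n \<le> T R ^ n"
        using T_mono[of r R] R pos by (intro power_mono) auto
      moreover have "\<rho> * T R ^ n \<le> 1 * T R ^ n"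
        using pos \<rho> by (intro mult_right_mono) auto
      ultimately show ?thesis by (simp add: algebra_simps)
    qed
    finally have "e * (1 - \<rho>) \<le> 4 * T R ^ n"
      unfolding \<delta>(2) by (simp add: field_simps)
    then have "e \<le> A * T R ^ n"
      using \<rho> by (simp add: A_def field_simps)
    also have "\<dots> \<le> A * (C * nlogn n) ^ n"
      using TR pos \<rho> by (intro mult_left_mono power_mono) (auto simp: A_def)
    finally have "e \<le> A * (C * nlogn n) ^ n" .
    moreover have "(\<integral>x. x ^ n \<partial>N) = e"
      unfolding e_def using nonneg by (intro integral_cong_AE) auto
    ultimately show ?thesis by simp
  qed
  moreover have "0 < C" using K \<open>0 < c\<close> by (simp add: C_def)
  ultimately show ?thesis by (rule that[rotated])
qed

end

lemma product_majorant_of_growth: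
  fixes m :: "nat \<Rightarrow> real" and A C :: real
  assumes "0 < C" and m: "\<And>n. 0 \<le> m n" "\<And>n. m n \<le> A * (C * nlogn n) ^ n"
  obtains \<mu> :: "nat \<Rightarrow> real" where "mono \<mu>" "\<And>j. 0 < \<mu> j" "\<And>n. m n \<le> A * (\<Prod>j<n. \<mu> j)"
    "\<not> summable (\<lambda>j. 1 / \<mu> (2 * j))"
proof
  define \<mu> where "\<mu> j = C * exp 3 * nlogn (Suc j)" for j
  have pos: "0 < nlogn j" for j using nlogn_ge_one[of j] by simp
  show "mono \<mu>"
    using \<open>0 < C\<close> by (auto simp: \<mu>_def intro!: monoI mult_left_mono monoD[OF mono_nlogn])
  show "0 < \<mu> j" for j
    using \<open>0 < C\<close> pos by (simp add: \<mu>_def)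
  have A: "0 \<le> A" using m[of 0] by simp
  show "m n \<le> A * (\<Prod>j<n. \<mu> j)" for n
  proof -
    have "(C * nlogn n) ^ n \<le> C ^ n * (\<Prod>j<n. exp 3 * nlogn (Suc j))"
      using nlogn_power_le_prod[of n] \<open>0 < C\<close> by (simp add: power_mult_distrib)
    also have "\<dots> = (\<Prod>j<n. \<mu> j)"
      by (simp add: \<mu>_def prod.distrib mult_ac)
    finally show ?thesis
      using m(2)[of n] A by (meson mult_left_mono order_trans)
  qed
  show "\<not> summable (\<lambda>j. 1 / \<mu> (2 * j))"
  proof
    assume "summable (\<lambda>j. 1 / \<mu> (2 * j))"
    then have "summable (\<lambda>j. C * exp 3 * (1 / \<mu> (2 * j)))"
      by (rule summable_mult)
    then show False
      using not_summable_inverse_nlogn \<open>0 < C\<close> by (simp add: \<mu>_def)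
  qed
qed

text \<open>
  Besides the contraction of the density, the shift must not stretch lengths too much: as \<open>T'\<close> tends
  to 1, it stays below a number \<open>\<kappa> > 1\<close> with \<open>q \<kappa> < 1\<close> from some point on. The bounds
  \<open>\<alpha> \<le> 1\<close> and \<open>ln (ln x) \<le> ln x\<close> keep the displacement logarithmic.
\<close>
lemma eventual_tail_contraction:
  fixes g :: "real \<Rightarrow> real" and a \<alpha> :: real
  assumes "0 < a" "0 \<le> \<alpha>" "\<alpha> \<le> 1" and g: "\<And>x. x0 \<le> x \<Longrightarrow> 0 < g x"
    and lim: "Limsup at_top (\<lambda>x. ereal (g (x + a * ln x powr \<alpha> + ln (ln x)) / g x)) < 1"
  defines "T \<equiv> \<lambda>x. x + a * ln x powr \<alpha> + ln (ln x)"
    and "T' \<equiv> \<lambda>x. 1 + a * (\<alpha> * ln x powr (\<alpha> - 1) / x) + 1 / (x * ln x)"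
  obtains r q \<kappa> where "exp 1 \<le> r" "x0 \<le> r" "0 < q" "0 < \<kappa>" "q * \<kappa> < 1"
    "\<And>x. r \<le> x \<Longrightarrow> g (T x) \<le> q * g x"
    "\<And>x. r \<le> x \<Longrightarrow> (T has_real_derivative T' x) (at x)"
    "continuous_on {r..} T'"
    "\<And>x. r \<le> x \<Longrightarrow> 0 \<le> T' x" "\<And>x. r \<le> x \<Longrightarrow> T' x \<le> \<kappa>"
    "\<And>x. r \<le> x \<Longrightarrow> x \<le> T x" "\<And>x. r \<le> x \<Longrightarrow> T x \<le> x + (a + 1) * ln x"
proof -
  obtain q0 where q0: "Limsup at_top (\<lambda>x. ereal (g (T x) / g x)) < ereal q0" "ereal q0 < 1"
    using ereal_dense2[OF lim] unfolding T_def by blast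
  \<comment> \<open>The bound \<open>q0\<close> can be replaced by a larger one; this makes positivity immediate.\<close>
  define q where "q = max q0 (1 / 2)"
  have q: "0 < q" "q < 1" using q0(2) by (auto simp: q_def)
  have "eventually (\<lambda>x. ereal (g (T x) / g x) < ereal q0) at_top"
    using q0(1) by (rule Limsup_lessD)
  then obtain x1 where x1: "\<And>x. x1 \<le> x \<Longrightarrow> g (T x) / g x < q0"
    by (auto simp: eventually_at_top_linorder)
  \<comment> \<open>The midpoint of 1 and \<open>1 / q\<close>.\<close>
  define \<kappa> where "\<kappa> = (1 + 1 / q) / 2"
  have \<kappa>: "1 < \<kappa>" "q * \<kappa> < 1" using q by (auto simp: \<kappa>_def field_simps)
  define r where "r = max (max x0 x1) (max (exp 1) ((a + 1) / (\<kappa> - 1)))"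
  have r: "x0 \<le> r" "x1 \<le> r" "exp 1 \<le> r" "(a + 1) / (\<kappa> - 1) \<le> r"
    by (auto simp: r_def)
  have big: "1 < x" "0 < x" "1 \<le> ln x" if "r \<le> x" for x
  proof -
    have "exp 1 \<le> x" using that r by simp
    moreover have "1 < exp (1::real)" by simp
    ultimately show "1 < x" "0 < x" by linarith+
    with \<open>exp 1 \<le> x\<close> show "1 \<le> ln x" by (simp add: ln_ge_iff)
  qed
  show ?thesis
  proof (rule that[of r q \<kappa>])
    fix x assume x: "r \<le> x"
    note b = big[OF x]
    have gx: "0 < g x" using g r x by simp
    have "g (T x) / g x \<le> q" using x1[of x] r x by (simp add: q_def)
    then show "g (T x) \<le> q * g x" using gx by (simp add: field_simps)
    show "(T has_real_derivative T' x) (at x)"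
      unfolding T_def T'_def using b
      by (auto intro!: derivative_eq_intros simp: field_simps)
    show "0 \<le> T' x" unfolding T'_def using b assms by (auto intro!: add_nonneg_nonneg)
    have "\<alpha> * ln x powr (\<alpha> - 1) \<le> 1 * 1"
      using b assms powr_mono[of "\<alpha> - 1" 0 "ln x"] by (intro mult_mono) auto
    then have "a * (\<alpha> * ln x powr (\<alpha> - 1) / x) \<le> a * (1 / x)"
      using b assms by (intro mult_left_mono divide_right_mono) auto
    moreover have "1 / (x * ln x) \<le> 1 / x"
      using b by (simp add: field_simps)
    ultimately have "T' x \<le> 1 + (a + 1) / x"
      by (simp add: T'_def add_divide_distrib)
    also have "(a + 1) / x \<le> \<kappa> - 1"
    proof -
      have "(a + 1) / (\<kappa> - 1) \<le> x" using r x by simp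
      then show ?thesis using b \<kappa> by (simp add: pos_divide_le_eq mult.commute)
    qed
    finally show "T' x \<le> \<kappa>" by simp
    show "x \<le> T x" unfolding T_def using b assms by simp
    have "ln x powr \<alpha> \<le> ln x" using b assms powr_mono[of \<alpha> 1 "ln x"] by simp
    then have "a * ln x powr \<alpha> \<le> a * ln x" using assms by simp
    moreover have "ln (ln x) \<le> ln x" using ln_le_minus_one[of "ln x"] b by linarith
    ultimately show "T x \<le> x + (a + 1) * ln x"
      unfolding T_def by (simp add: algebra_simps)
  next
    show "continuous_on {r..} T'"
      unfolding T'_def using big by (force intro!: continuous_intros)
  qed (use r q \<kappa> in auto)
qed

section \<open>Determinacy of the variable and its square\<close>

lemma nonneg_rv_distribution:
  assumes "nonneg_rv_all_moments M X"
  shows "nonneg_distribution (distr M borel X)"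
    and "integrable (distr M borel X) (\<lambda>x. x ^ n)"
    and "(\<integral>x. x ^ n \<partial>distr M borel X) = (\<integral>\<omega>. X \<omega> ^ n \<partial>M)"
proof -
  interpret prob_space M using assms by (simp add: nonneg_rv_all_moments_def)
  have X [measurable]: "X \<in> borel_measurable M" and nn: "\<And>\<omega>. \<omega> \<in> space M \<Longrightarrow> 0 \<le> X \<omega>"
    and int: "\<And>n. 1 \<le> n \<Longrightarrow> integrable M (\<lambda>\<omega>. X \<omega> ^ n)"
    using assms by (auto simp: nonneg_rv_all_moments_def)
  have "real_distribution (distr M borel X)" by (rule real_distribution_distr) simp
  moreover have "AE x in distr M borel X. 0 \<le> x"
    by (subst AE_distr_iff) (auto intro!: AE_I2 nn)
  ultimately show "nonneg_distribution (distr M borel X)"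
    by (simp add: nonneg_distribution_def nonneg_distribution_axioms_def)
  have "integrable M (\<lambda>\<omega>. X \<omega> ^ n)"
    using int[of n] by (cases "n = 0") auto
  then show "integrable (distr M borel X) (\<lambda>x. x ^ n)"
    by (subst integrable_distr_eq) auto
  show "(\<integral>x. x ^ n \<partial>distr M borel X) = (\<integral>\<omega>. X \<omega> ^ n \<partial>M)"
    by (subst integral_distr) auto
qed

text \<open>
  Moments of order 0 are those of any probability law, so they can be included among the data.
\<close>
lemma M_det_if_unique:
  assumes X: "nonneg_rv_all_moments M X"
    and uniq: "\<And>N. \<lbrakk>nonneg_distribution N; \<And>n. integrable N (\<lambda>x. x ^ n);
      \<And>n. (\<integral>x. x ^ n \<partial>N) = (\<integral>x. x ^ n \<partial>distr M borel X)\<rbrakk> \<Longrightarrow> N = distr M borel X"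
  shows "M_det M X"
  unfolding M_det_def
proof (intro conjI allI impI X)
  fix N :: "real measure"
  assume "real_distribution N" "AE x in N. 0 \<le> x"
    and mom: "\<forall>n\<ge>1. integrable N (\<lambda>x. x ^ n) \<and> (\<integral>x. x ^ n \<partial>N) = (\<integral>\<omega>. X \<omega> ^ n \<partial>M)"
  then interpret nonneg_distribution N
    by (simp add: nonneg_distribution_def nonneg_distribution_axioms_def)
  interpret M: prob_space M using X by (simp add: nonneg_rv_all_moments_def)
  show "N = distr M borel X"
  proof (rule uniq)
    show "nonneg_distribution N" by unfold_locales
    fix n
    have mom': "integrable N (\<lambda>x. x ^ n) \<and> (\<integral>x. x ^ n \<partial>N) = (\<integral>\<omega>. X \<omega> ^ n \<partial>M)"
    proof (cases "n = 0")
      case True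
      then show ?thesis using prob_space M.prob_space by simp
    next
      case False
      then show ?thesis using mom by simp
    qed
    then show "integrable N (\<lambda>x. x ^ n)" by blast
    show "(\<integral>x. x ^ n \<partial>N) = (\<integral>x. x ^ n \<partial>distr M borel X)"
      unfolding nonneg_rv_distribution(3)[OF X] using mom' by blast
  qed
qed

text \<open>
  One bound serves both variables: the criterion on the line uses the even moments of \<open>Y\<close>, and the
  even moments of the randomly signed square root of the law of \<open>Y\<^sup>2\<close> are the same numbers.
\<close>
lemma M_det_of_moment_bound:
  fixes \<mu> :: "nat \<Rightarrow> real"
  assumes Y: "nonneg_rv_all_moments M Y"
    and \<mu>: "mono \<mu>" "\<And>j. 0 < \<mu> j" "\<not> summable (\<lambda>j. 1 / \<mu> (2 * j))"
    and bound: "\<And>m. (\<integral>\<omega>. Y \<omega> ^ (2 * m) \<partial>M) \<le> A * (\<Prod>j<2 * m. \<mu> j)"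
  shows "M_det M Y" and "M_det M (\<lambda>\<omega>. (Y \<omega>)\<^sup>2)"
proof -
  let ?P = "distr M borel Y" and ?P2 = "distr M borel (\<lambda>\<omega>. (Y \<omega>)\<^sup>2)"
  show "M_det M Y"
  proof (rule M_det_if_unique[OF Y])
    fix N
    assume "nonneg_distribution N" and N: "\<And>n. integrable N (\<lambda>x. x ^ n)"
      "\<And>n. (\<integral>x. x ^ n \<partial>N) = (\<integral>x. x ^ n \<partial>?P)"
    then interpret nonneg_distribution N by simp
    interpret P: nonneg_distribution ?P by (rule nonneg_rv_distribution[OF Y])
    show "N = ?P"
    proof (rule hamburger_determinacy[OF _ _ N(1) _ N(2) \<mu>(1,2) _ \<mu>(3)])
      show "(\<integral>x. x ^ (2 * m) \<partial>?P) \<le> A * (\<Prod>j<2 * m. \<mu> j)" for m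
        unfolding nonneg_rv_distribution(3)[OF Y] by (rule bound)
    qed (rule real_distribution_axioms P.real_distribution_axioms nonneg_rv_distribution(2)[OF Y])+
  qed
  have Y2: "nonneg_rv_all_moments M (\<lambda>\<omega>. (Y \<omega>)\<^sup>2)"
    using Y by (auto simp: nonneg_rv_all_moments_def simp flip: power_mult)
  show "M_det M (\<lambda>\<omega>. (Y \<omega>)\<^sup>2)"
  proof (rule M_det_if_unique[OF Y2])
    fix N
    assume "nonneg_distribution N" and N: "\<And>n. integrable N (\<lambda>x. x ^ n)"
      "\<And>n. (\<integral>x. x ^ n \<partial>N) = (\<integral>x. x ^ n \<partial>?P2)"
    then interpret nonneg_distribution N by simp
    interpret P2: nonneg_distribution ?P2 by (rule nonneg_rv_distribution[OF Y2])
    have P2: "integrable ?P2 (\<lambda>x. x ^ n)" for n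
      by (rule nonneg_rv_distribution[OF Y2])
    have "random_sign_sqrt N = random_sign_sqrt ?P2"
    proof (rule hamburger_determinacy[OF _ _ _ _ _ \<mu>(1,2) _ \<mu>(3)])
      show "(\<integral>x. x ^ (2 * m) \<partial>random_sign_sqrt ?P2) \<le> A * (\<Prod>j<2 * m. \<mu> j)" for m
        using bound[of m]
        by (simp add: P2.moment_random_sign_sqrt[OF P2] nonneg_rv_distribution(3)[OF Y2]
            flip: power_mult)
      show "(\<integral>x. x ^ n \<partial>random_sign_sqrt N) = (\<integral>x. x ^ n \<partial>random_sign_sqrt ?P2)" for n
        by (simp add: moment_random_sign_sqrt[OF N(1)] P2.moment_random_sign_sqrt[OF P2] N(2))
    qed (intro real_distribution_random_sign_sqrt P2.real_distribution_random_sign_sqrt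
        integrable_random_sign_sqrt P2.integrable_random_sign_sqrt N(1) P2)+
    then show "N = ?P2"
      using square_random_sign_sqrt P2.square_random_sign_sqrt by metis
  qed
qed

theorem corollary4:
  fixes M :: "'a measure" and Y :: "'a \<Rightarrow> real"
    and g :: "real \<Rightarrow> real" and a \<alpha> x0 :: real
  assumes "a > 0" and "0 \<le> \<alpha>" and "\<alpha> \<le> 1"
    and "nonneg_rv_all_moments M Y"
    and "x0 > exp 1"
    and "abs_cont_from_with_density (cdf (distr M borel Y)) x0 g"
    and "\<forall>x\<ge>x0. g x > 0"
    and "Limsup at_top (\<lambda>x. ereal (g (x + a * ln x powr \<alpha> + ln (ln x)) / g x)) < 1"
  shows "M_det M Y \<and> M_det M (\<lambda>\<omega>. (Y \<omega>)\<^sup>2)"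
proof -
  let ?P = "distr M borel Y"
  interpret nonneg_distribution ?P by (rule nonneg_rv_distribution[OF assms(4)])
  interpret eventual_density ?P g x0
    using assms by unfold_locales (auto intro: less_imp_le)
  define T where "T = (\<lambda>x. x + a * ln x powr \<alpha> + ln (ln x))"
  define T' where "T' = (\<lambda>x. 1 + a * (\<alpha> * ln x powr (\<alpha> - 1) / x) + 1 / (x * ln x))"
  obtain r q \<kappa> where r: "exp 1 \<le> r" "x0 \<le> r" and q: "0 < q" "0 < \<kappa>" "q * \<kappa> < 1"
    and contract: "\<And>x. r \<le> x \<Longrightarrow> g (T x) \<le> q * g x"
    and der: "\<And>x. r \<le> x \<Longrightarrow> (T has_real_derivative T' x) (at x)"
    and cont: "continuous_on {r..} T'"
    and T': "\<And>x. r \<le> x \<Longrightarrow> 0 \<le> T' x" "\<And>x. r \<le> x \<Longrightarrow> T' x \<le> \<kappa>"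
    and T: "\<And>x. r \<le> x \<Longrightarrow> x \<le> T x" "\<And>x. r \<le> x \<Longrightarrow> T x \<le> x + (a + 1) * ln x"
    using eventual_tail_contraction[OF assms(1-3) _ assms(8), of x0] assms(7)
    unfolding T_def T'_def by blast
  have T_meas: "T \<in> borel_measurable borel" unfolding T_def by measurable
  have T_mono: "T x \<le> T y" if "r \<le> x" "x \<le> y" for x y
    using that by (intro deriv_nonneg_imp_mono[where g = T and g' = T'] der T') auto
  obtain A C where "0 < C" and AC: "\<And>n. (\<integral>x. x ^ n \<partial>?P) \<le> A * (C * nlogn n) ^ n"
  proof (rule moment_growth_of_tail_contraction[of r T "a + 1" "q * \<kappa>"])
    show "(\<integral>\<^sup>+x. ennreal (\<bar>x\<bar> ^ n) * indicator {T r<..} x \<partial>?P)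
        \<le> ennreal (q * \<kappa>) * (\<integral>\<^sup>+x. ennreal (\<bar>T x\<bar> ^ n) * indicator {r<..} x \<partial>?P)" for n
      using q by (intro nn_integral_tail_shift_le[where T' = T'] r der cont T' T contract T_meas)
        auto
    show "0 < q * \<kappa>" and "0 < a + 1"
      using q assms(1) by simp_all
    fix A C
    assume "0 < C" and "\<And>n. (\<integral>x. x ^ n \<partial>?P) \<le> A * (C * nlogn n) ^ n"
    then show thesis by (rule that)
  qed (rule r q T T_mono T_meas nonneg_rv_distribution(2)[OF assms(4)] | assumption)+
  have moment_nonneg: "0 \<le> (\<integral>x. x ^ n \<partial>?P)" for n
    using nonneg by (intro integral_nonneg_AE) auto
  obtain \<mu> where \<mu>: "mono \<mu>" "\<And>j. 0 < \<mu> j"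
    and bound: "\<And>n. (\<integral>x. x ^ n \<partial>?P) \<le> A * (\<Prod>j<n. \<mu> j)"
    and div: "\<not> summable (\<lambda>j. 1 / \<mu> (2 * j))"
    using product_majorant_of_growth[OF \<open>0 < C\<close> moment_nonneg AC] by blast
  have "(\<integral>\<omega>. Y \<omega> ^ (2 * m) \<partial>M) \<le> A * (\<Prod>j<2 * m. \<mu> j)" for m
    using bound[of "2 * m"] unfolding nonneg_rv_distribution(3)[OF assms(4)] .
  then show ?thesis
    by (intro conjI M_det_of_moment_bound[OF assms(4) \<mu> div])
qed

end
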